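(* Let $n\ge2$ and let $\mathcal S=((X,d),(f_i)_{i\in\{1,\dots,n\}})$ be an iterated function system, i.e. $(X,d)$ is a complete metric space and each $f_i:X\to X$ is a Banach contraction. Let $\gamma_i$ be the unique fixed point of $f_i$, and let $c_i\in[0,1)$ be such that $d(f_i(x),f_i(y))\le c_i\,d(x,y)$ for all $x,y\in X$, for each $i\in\{1,\dots,n\}$. Let $i'\in\{1,\dots,n\}$ be such that $c_{i'}=\max\{c_1,\dots,c_n\}$, let $i''\in\{1,\dots,n\}\setminus\{i'\}$ be such that $c_{i''}=\max\{c_i : i\in\{1,\dots,n\}\setminus\{i'\}\}$, and let $M=\max_{i,j\in\{1,\dots,n\}}d(\gamma_i,\gamma_j)$. Then the numbers $$\rho_{i'}=Mc_{i'}\frac{1+c_{i''}}{1-c_{i'}c_{i''}}\qquad\text{and}\qquad \rho_i=Mc_i\frac{1+c_{i'}}{1-c_{i'}c_{i''}}\quad\text{for all } i\in\{1,\dots,n\}\setminus\{i'\}$$ form a solution of the system of $n$ equations $$\rho_i=c_i\left(M+\max_{j\in\{1,\dots,n\}\setminus\{i\}}\rho_j\right),\qquad i\in\{1,\dots,n\}.$$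
   Context: A Banach contraction on $(X,d)$ is a map $f:X\to X$ for which there is a constant $c\in[0,1)$ with $d(f(x),f(y))\le c\,d(x,y)$ for all $x,y\in X$. *)

theory Defs
  imports "HOL-Analysis.Analysis"
begin

definition banach_contraction :: "'a set \<Rightarrow> ('a \<Rightarrow> 'a \<Rightarrow> real) \<Rightarrow> ('a \<Rightarrow> 'a) \<Rightarrow> bool" where
  "banach_contraction X d f \<longleftrightarrow>
     f \<in> X \<rightarrow> X \<and> (\<exists>c\<in>{0..<1}. \<forall>x\<in>X. \<forall>y\<in>X. d (f x) (f y) \<le> c * d x y)"

(* The maps of the system are f 1, ..., f n; the values of f at other indices are irrelevant. *)
definition iterated_function_system ::
    "'a set \<Rightarrow> ('a \<Rightarrow> 'a \<Rightarrow> real) \<Rightarrow> nat \<Rightarrow> (nat \<Rightarrow> 'a \<Rightarrow> 'a) \<Rightarrow> bool" where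
  "iterated_function_system X d n f \<longleftrightarrow>
     Metric_space X d \<and> Metric_space.mcomplete X d \<and>
     (\<forall>i\<in>{1..n}. banach_contraction X d (f i))"

definition is_unique_fixed_point :: "'a set \<Rightarrow> ('a \<Rightarrow> 'a) \<Rightarrow> 'a \<Rightarrow> bool" where
  "is_unique_fixed_point X f x \<longleftrightarrow> {y \<in> X. f y = y} = {x}"

end

theory Submission
  imports Defs
begin

text \<open>
  The largest of the \<open>\<rho> j\<close> is \<open>\<rho> i'\<close>, and the largest with \<open>j \<noteq> i'\<close> is \<open>\<rho> i''\<close>, so each
  maximum in the system is attained at \<open>i'\<close> (at \<open>i''\<close> for \<open>i = i'\<close>) and the system becomes linear.
\<close>

theorem proposition3p2:
  fixes X :: "'a set" and d :: "'a \<Rightarrow> 'a \<Rightarrow> real"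
    and n :: nat and f :: "nat \<Rightarrow> 'a \<Rightarrow> 'a"
    and \<gamma> :: "nat \<Rightarrow> 'a" and c \<rho> :: "nat \<Rightarrow> real"
    and i' i'' :: nat and M :: real
  assumes n: "n \<ge> 2"
    and ifs: "iterated_function_system X d n f"
    and \<gamma>: "\<forall>i\<in>{1..n}. is_unique_fixed_point X (f i) (\<gamma> i)"
    and c_range: "\<forall>i\<in>{1..n}. 0 \<le> c i \<and> c i < 1"
    and c_contr: "\<forall>i\<in>{1..n}. \<forall>x\<in>X. \<forall>y\<in>X. d (f i x) (f i y) \<le> c i * d x y"
    and i': "i' \<in> {1..n}" "c i' = (MAX i\<in>{1..n}. c i)"
    and i'': "i'' \<in> {1..n} - {i'}" "c i'' = (MAX i\<in>{1..n} - {i'}. c i)"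
    and M: "M = (MAX (i, j)\<in>{1..n} \<times> {1..n}. d (\<gamma> i) (\<gamma> j))"
    and \<rho>_i': "\<rho> i' = M * c i' * ((1 + c i'') / (1 - c i' * c i''))"
    and \<rho>_other: "\<forall>i\<in>{1..n} - {i'}. \<rho> i = M * c i * ((1 + c i') / (1 - c i' * c i''))"
  shows "\<forall>i\<in>{1..n}. \<rho> i = c i * (M + (MAX j\<in>{1..n} - {i}. \<rho> j))"
proof -
  let ?I = "{1..n}" and ?a = "c i'" and ?b = "c i''"
  \<comment> \<open>\<open>K\<close> is the factor shared by all \<open>\<rho> j\<close>. Writing
    \<open>M\<close> as \<open>K * (1 - ?a * ?b)\<close> as well clears the denominators, so the
    system reduces to polynomial identities in the \<open>c j\<close>.\<close>
  define K where "K = M / (1 - ?a * ?b)"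
  \<comment> \<open>The sign of \<open>M\<close> matters because it gives \<open>0 \<le> K\<close>:
    multiplying by \<open>K\<close> then preserves the order of the polynomial factors. A diagonal
    pair already bounds \<open>M\<close> below by a distance.\<close>
  have M_nonneg: "0 \<le> M"
  proof -
    have "d (\<gamma> 1) (\<gamma> 1) \<le> M"
      unfolding M using n by (intro Max_ge) (auto intro!: rev_image_eqI[of "(1, 1)"])
    then show ?thesis
      using ifs unfolding iterated_function_system_def
      by (meson Metric_space.nonneg order_trans)
  qed
  have a: "0 \<le> ?a" "?a < 1" and b: "0 \<le> ?b" "?b < 1"
    using c_range i'(1) i''(1) by auto
  have ab: "?a * ?b < 1"
    using a b mult_left_le[of ?b ?a] by linarith
  have K: "0 \<le> K"
    unfolding K_def using M_nonneg ab by simp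
  have c_le_a: "c j \<le> ?a" if "j \<in> ?I" for j
    unfolding i'(2) using that by (intro Max_ge) auto
  have c_le_b: "c j \<le> ?b" if "j \<in> ?I - {i'}" for j
    unfolding i''(2) using that by (intro Max_ge) auto
  have M_eq: "M = K * (1 - ?a * ?b)"
    unfolding K_def using ab by simp
  have rho_i': "\<rho> i' = K * (?a * (1 + ?b))"
    unfolding \<rho>_i' K_def by simp
  have rho_j: "\<rho> j = K * (c j * (1 + ?a))" if "j \<in> ?I - {i'}" for j
    using \<rho>_other that unfolding K_def by simp
  have rho_le_i'': "\<rho> j \<le> \<rho> i''" if "j \<in> ?I - {i'}" for j
    unfolding rho_j[OF that] rho_j[OF i''(1)]
    using K a c_le_b[OF that] by (intro mult_left_mono mult_right_mono) auto
  have rho_le_i': "\<rho> j \<le> \<rho> i'" if j: "j \<in> ?I" for j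
  proof (cases "j = i'")
    case False
    have "c j * (1 + ?a) = c j + ?a * c j"
      by (simp add: algebra_simps)
    \<comment> \<open>The two occurrences of \<open>c j\<close> are bounded differently: the first
      by the overall maximum \<open>?a\<close>, the second, as j differs from i', by the runner-up
      \<open>?b\<close>.\<close>
    also have "\<dots> \<le> ?a + ?a * ?b"
      using False j a c_le_a c_le_b by (intro add_mono mult_left_mono) auto
    finally have "c j * (1 + ?a) \<le> ?a * (1 + ?b)"
      by (simp add: algebra_simps)
    then show ?thesis
      using False j K by (auto simp: rho_i' rho_j intro: mult_left_mono)
  qed simp
  show ?thesis
  proof
    fix i assume i: "i \<in> ?I"
    show "\<rho> i = c i * (M + (MAX j\<in>?I - {i}. \<rho> j))"
    proof (cases "i = i'")
      case True
      have "(MAX j\<in>?I - {i'}. \<rho> j) = \<rho> i''"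
        using i''(1) by (intro Max_eqI) (auto intro!: rho_le_i'')
      \<comment> \<open>After division by \<open>K * ?a\<close> this is
        \<open>(1 - ?a * ?b) + ?b * (1 + ?a) = 1 + ?b\<close>; the mixed products cancel. No
        division is actually performed, so zero values are harmless.\<close>
      then show ?thesis
        unfolding True rho_i' rho_j[OF i''(1)] M_eq by (simp add: algebra_simps)
    next
      case False
      have "(MAX j\<in>?I - {i}. \<rho> j) = \<rho> i'"
        using i'(1) False by (intro Max_eqI) (auto intro!: rho_le_i')
      moreover have "\<rho> i = K * (c i * (1 + ?a))"
        using False i by (intro rho_j) auto
      \<comment> \<open>The same cancellation with the roles of \<open>?a\<close> and
        \<open>?b\<close> exchanged: \<open>(1 - ?a * ?b) + ?a * (1 + ?b) = 1 + ?a\<close>.\<close>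
      ultimately show ?thesis
        unfolding rho_i' M_eq by (simp add: algebra_simps)
    qed
  qed
qed

end
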